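(* Let $F$ be the simplicial complex on vertex set $\{v_1,v_2,v_3,v_4\}$ whose edge set is the downward closure of $\{v_1v_2v_3,\ v_2v_3v_4,\ v_1v_4\}$. For every $\varepsilon>0$ there is $n_0\in\mathbb N$ such that for every $n\ge n_0$, $$\Big(\frac29-\varepsilon\Big)\binom n3\le \mathrm{ex}(n,F)\le \Big(\frac29+\varepsilon\Big)\binom n3.$$
   Context: A simplicial complex is a pair $H=(V,E)$ with $E\subseteq\mathscr P(V)$ closed under taking subsets; all sets in $E$ (including the empty set and singletons) count as edges. $H$ contains a copy of $F$ if there is an injection $\varphi:V(F)\to V(H)$ with $\varphi(e)\in E(H)$ for every $e\in E(F)$. $\mathrm{ex}(n,F)$ is the maximum number of edges of a simplicial complex on $n$ vertices containing no copy of $F$. *)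

theory Defs
  imports Complex_Main
begin

(* A complex is the pair (V, E). A vertex need not be a singleton edge, and E may be empty. *)
type_synonym 'a complex_pair = "'a set \<times> 'a set set"

definition simplicial_complex :: "'a complex_pair \<Rightarrow> bool" where
  "simplicial_complex H \<longleftrightarrow>
     snd H \<subseteq> Pow (fst H) \<and> (\<forall>e\<in>snd H. \<forall>f. f \<subseteq> e \<longrightarrow> f \<in> snd H)"

definition contains_copy :: "'a complex_pair \<Rightarrow> 'b complex_pair \<Rightarrow> bool" where
  "contains_copy H F \<longleftrightarrow>
     (\<exists>\<phi>. inj_on \<phi> (fst F) \<and> \<phi> ` fst F \<subseteq> fst H \<and> (\<forall>e\<in>snd F. \<phi> ` e \<in> snd H))"

(* Vertices are taken in nat without loss of generality, as the property is invariant under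
   relabelling. The set is finite, and it is nonempty if F has an edge (take E = {}). *)
definition free_edge_counts :: "nat \<Rightarrow> 'b complex_pair \<Rightarrow> nat set" where
  "free_edge_counts n F =
     {card (snd H) | H :: nat complex_pair.
        simplicial_complex H \<and> finite (fst H) \<and> card (fst H) = n \<and> \<not> contains_copy H F}"

definition ex_num :: "nat \<Rightarrow> 'b complex_pair \<Rightarrow> nat" where
  "ex_num n F = Max (free_edge_counts n F)"

definition down_closure :: "'a set set \<Rightarrow> 'a set set" where
  "down_closure S = {f. \<exists>e\<in>S. f \<subseteq> e}"

definition F_complex :: "nat complex_pair" where
  "F_complex = ({1, 2, 3, 4}, down_closure {{1, 2, 3}, {2, 3, 4}, {1, 4}})"

lemma simplicial_complex_F_complex: "simplicial_complex F_complex"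
  unfolding simplicial_complex_def F_complex_def down_closure_def by auto

lemma finite_free_edge_counts: "finite (free_edge_counts n F)"
proof (rule finite_subset)
  show "free_edge_counts n F \<subseteq> {..2 ^ n}"
  proof
    fix m assume "m \<in> free_edge_counts n F"
    then obtain H :: "nat complex_pair" where H: "m = card (snd H)" "simplicial_complex H"
      "finite (fst H)" "card (fst H) = n"
      unfolding free_edge_counts_def by blast
    then have "card (snd H) \<le> card (Pow (fst H))"
      by (intro card_mono) (auto simp: simplicial_complex_def)
    with H show "m \<in> {..2 ^ n}" by (simp add: card_Pow)
  qed
qed simp

lemma free_edge_counts_nonempty:
  assumes "snd F \<noteq> {}"
  shows "free_edge_counts n F \<noteq> {}"
proof -
  let ?H = "({..<n}, {}) :: nat complex_pair"
  have "simplicial_complex ?H" "finite (fst ?H)" "card (fst ?H) = n" "\<not> contains_copy ?H F"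
    using assms by (auto simp: simplicial_complex_def contains_copy_def)
  then show ?thesis unfolding free_edge_counts_def by blast
qed

end

theory Submission
  imports Defs "HOL-Real_Asymp.Real_Asymp"
begin

text \<open>In an \<open>F\<close>-free complex no edge has four vertices, and the triples form a cancellative
  3-graph: there are no distinct triples \<open>A\<close>, \<open>B\<close> and a triple \<open>C\<close> containing \<open>A \<triangle> B\<close>. It thus suffices
  to show Bollobas' bound \<open>n\<^sup>3 / 27\<close> for the latter, and we prove the weighted (Lagrangian) form: the
  sum over all triples of the products of their vertex weights is at most \<open>(\<Sum>x)\<^sup>3 / 27\<close>. Moving
  weight between vertices that lie in no common triple (as Frankl and Roedl do) reduces this to the case
  where every pair of vertices is covered. Cancellativity then forces every pair to lie in exactly
  one triple, where AM-GM applies. Balanced complete tripartite complexes, realised by residues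
  modulo 3, give the lower bound.\<close>

section \<open>Cancellative triple systems\<close>

text \<open>\<open>C\<close> need not be required to differ from \<open>A\<close> and
  \<open>B\<close>: \<open>sym_diff A B \<subseteq> A\<close> means \<open>B \<subseteq> A\<close>,
  which is impossible for distinct triples.\<close>

definition cancellative :: "'a set set \<Rightarrow> bool" where
  "cancellative E \<longleftrightarrow>
     (\<forall>A\<in>E. \<forall>B\<in>E. \<forall>C\<in>E. A \<noteq> B \<longrightarrow> \<not> sym_diff A B \<subseteq> C)"

lemma cancellative_subset: "cancellative E \<Longrightarrow> E' \<subseteq> E \<Longrightarrow> cancellative E'"
  unfolding cancellative_def by blast

lemma card_3_obtain_third:
  assumes "card e = 3" "u \<in> e" "v \<in> e" "u \<noteq> v"
  obtains w where "e = {u, v, w}" "w \<noteq> u" "w \<noteq> v"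
proof -
  have fin: "finite e"
    using assms(1) card.infinite by fastforce
  have "card (e - {u, v}) = 1"
    using assms fin by (simp add: card_Diff_subset)
  then obtain w where "e - {u, v} = {w}"
    by (auto simp: card_1_singleton_iff)
  then show ?thesis
    using assms that[of w] by blast
qed

text \<open>Two edges \<open>{u, v, c}\<close> and \<open>{u, v, d}\<close> have symmetric
  difference \<open>{c, d}\<close>, and the edge covering the pair \<open>c\<close>,
  \<open>d\<close> would contain it.\<close>

lemma cancellative_covering_imp_linear:
  assumes canc: "cancellative E"
    and three: "\<And>e. e \<in> E \<Longrightarrow> card e = 3"
    and cover: "\<And>u v. u \<in> \<Union>E \<Longrightarrow> v \<in> \<Union>E \<Longrightarrow> u \<noteq> v \<Longrightarrow> \<exists>e\<in>E. u \<in> e \<and> v \<in> e"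
    and "e \<in> E" "f \<in> E" "u \<in> e \<inter> f" "v \<in> e \<inter> f" "u \<noteq> v"
  shows "e = f"
proof (rule ccontr)
  assume "e \<noteq> f"
  obtain c where c: "e = {u, v, c}" "c \<noteq> u" "c \<noteq> v"
    using card_3_obtain_third[of e u v] three assms by blast
  obtain d where d: "f = {u, v, d}" "d \<noteq> u" "d \<noteq> v"
    using card_3_obtain_third[of f u v] three assms by blast
  have "c \<noteq> d"
    using \<open>e \<noteq> f\<close> c d by auto
  then obtain g where "g \<in> E" "c \<in> g" "d \<in> g"
    using cover[of c d] c d assms by blast
  moreover have "sym_diff e f = {c, d}"
    using c d \<open>c \<noteq> d\<close> by auto
  ultimately have "sym_diff e f \<subseteq> g"
    by simp
  then show False
    using canc \<open>e \<noteq> f\<close> \<open>e \<in> E\<close> \<open>f \<in> E\<close> \<open>g \<in> E\<close> unfolding cancellative_def by auto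
qed

section \<open>Weight bound for linear triple systems\<close>

lemma amgm3_pow:
  fixes a b c :: real
  assumes "0 \<le> a" "0 \<le> b" "0 \<le> c"
  shows "27 * (a * b * c) \<le> (a + b + c) ^ 3"
proof -
  \<comment> \<open>The right-hand side equals
    \<open>2 * ((a + b + c) ^ 3 - 27 * (a * b * c))\<close>.\<close>
  have "0 \<le> (a + b + c) * ((a - b)\<^sup>2 + (b - c)\<^sup>2 + (a - c)\<^sup>2)
            + 6 * (a * (b - c)\<^sup>2 + b * (a - c)\<^sup>2 + c * (a - b)\<^sup>2)"
    using assms by (intro add_nonneg_nonneg mult_nonneg_nonneg) auto
  then show ?thesis
    by (simp add: power2_eq_square power3_eq_cube algebra_simps)
qed

lemma sum_off_diagonal_card_3:
  fixes x :: "'a \<Rightarrow> real"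
  assumes "a \<noteq> b" "b \<noteq> c" "a \<noteq> c" "e = {a, b, c}"
  shows "(\<Sum>(u, v)\<in>e \<times> e - Id. x u * x v) = 2 * (x a * x b + x b * x c + x a * x c)"
proof -
  have "e \<times> e - Id = {(a, b), (b, a), (b, c), (c, b), (a, c), (c, a)}"
    using assms by auto
  then show ?thesis
    using assms by (simp add: algebra_simps)
qed

text \<open>With \<open>g\<^sup>3\<close> the largest edge weight, AM-GM bounds three times the weight of an edge by \<open>g\<close>
  times the sum of its three pair products. As these pairs are distinct for distinct edges,
  the total weight is at most \<open>g (S\<^sup>2 - \<Sum>x\<^sup>2) / 6 \<le> g (S\<^sup>2 - 3 g\<^sup>2) / 6\<close> with \<open>S = \<Sum>x\<close>,
  which is maximal at \<open>g = S / 3\<close>.\<close>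

lemma linear_triple_system_weight_le:
  fixes x :: "'a \<Rightarrow> real"
  assumes fin: "finite V" and nn: "\<And>v. v \<in> V \<Longrightarrow> 0 \<le> x v"
    and sub: "\<And>e. e \<in> E \<Longrightarrow> e \<subseteq> V" and three: "\<And>e. e \<in> E \<Longrightarrow> card e = 3"
    and lin: "\<And>e f u v. \<lbrakk>e \<in> E; f \<in> E; u \<in> e \<inter> f; v \<in> e \<inter> f; u \<noteq> v\<rbrakk> \<Longrightarrow> e = f"
  shows "(\<Sum>e\<in>E. \<Prod>v\<in>e. x v) \<le> (\<Sum>v\<in>V. x v) ^ 3 / 27"
proof (cases "E = {}")
  case True
  then show ?thesis
    using nn by (simp add: sum_nonneg)
next
  case False
  define t where "t e = (\<Prod>v\<in>e. x v)" for e
  define S where "S = (\<Sum>v\<in>V. x v)"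
  have finE: "finite E"
    using fin sub by (meson Pow_iff finite_Pow_iff finite_subset subsetI)
  have t_nn: "0 \<le> t e" if "e \<in> E" for e
    unfolding t_def using nn sub that by (intro prod_nonneg) blast
  obtain m where m: "m \<in> E" "\<And>e. e \<in> E \<Longrightarrow> t e \<le> t m"
    using obtains_MAX[OF finE False, of t] finE by (metis Max_ge finite_imageI imageI)
  define g where "g = root 3 (t m)"
  have g: "0 \<le> g" "g ^ 3 = t m"
    using t_nn[OF m(1)] by (auto simp: g_def)
  \<comment> \<open>Ordered pairs are used so that the sum of \<open>q\<close> over all edges
    becomes a partial sum of the expansion of \<open>S\<^sup>2\<close> without its diagonal.\<close>
  define q where "q e = (\<Sum>(u, v)\<in>e \<times> e - Id. x u * x v)" for e
  have edge: "6 * t e \<le> g * q e" if e: "e \<in> E" for e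
  proof -
    obtain a b c where abc: "e = {a, b, c}" "a \<noteq> b" "b \<noteq> c" "a \<noteq> c"
      using three[OF e] by (auto simp: card_3_iff)
    define r where "r = x a * x b + x b * x c + x a * x c"
    have q: "q e = 2 * r"
      unfolding q_def r_def by (rule sum_off_diagonal_card_3) (use abc in auto)
    have te: "t e = x a * x b * x c"
      using abc by (simp add: t_def)
    have nn': "0 \<le> x a" "0 \<le> x b" "0 \<le> x c"
      using nn sub[OF e] abc by auto
    \<comment> \<open>AM-GM for the three pair products; their product is the square of
      \<open>t e\<close>.\<close>
    have "27 * ((x a * x b) * (x b * x c) * (x a * x c)) \<le> r ^ 3"
      unfolding r_def using nn' by (intro amgm3_pow) auto
    then have r: "27 * (t e)\<^sup>2 \<le> r ^ 3"
      by (simp add: te power2_eq_square algebra_simps)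
    have "(3 * t e) ^ 3 = t e * (27 * (t e)\<^sup>2)"
      by (simp add: power2_eq_square power3_eq_cube)
    also have "\<dots> \<le> t m * r ^ 3"
      using m(2)[OF e] t_nn[OF e] t_nn[OF m(1)] r by (intro mult_mono) auto
    also have "\<dots> = (g * r) ^ 3"
      by (simp add: g power_mult_distrib)
    finally have "3 * t e \<le> g * r"
      by (rule power_le_imp_le_base[where n = 2, unfolded Suc_numeral semiring_norm])
        (use g nn' r_def in auto)
    then show ?thesis
      by (simp add: q)
  qed
  have diag: "(\<Sum>(u, v)\<in>V \<times> V - Id. x u * x v) = S\<^sup>2 - (\<Sum>v\<in>V. (x v)\<^sup>2)"
  proof -
    have "S\<^sup>2 = (\<Sum>(u, v)\<in>V \<times> V. x u * x v)"
      unfolding S_def power2_eq_square by (simp add: sum_product sum.cartesian_product)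
    also have "\<dots> = (\<Sum>(u, v)\<in>V \<times> V - Id. x u * x v) + (\<Sum>(u, v)\<in>(\<lambda>v. (v, v)) ` V. x u * x v)"
      by (subst sum.union_disjoint[symmetric]) (use fin in \<open>auto intro!: sum.cong\<close>)
    also have "(\<Sum>(u, v)\<in>(\<lambda>v. (v, v)) ` V. x u * x v) = (\<Sum>v\<in>V. (x v)\<^sup>2)"
      by (subst sum.reindex) (auto simp: inj_on_def power2_eq_square)
    finally show ?thesis by simp
  qed
  have "(\<Sum>e\<in>E. q e) = (\<Sum>(u, v)\<in>(\<Union>e\<in>E. e \<times> e - Id). x u * x v)"
    unfolding q_def
  proof (rule sum.UNION_disjoint[symmetric, OF finE])
    show "\<forall>e\<in>E. finite (e \<times> e - Id)"
      using finite_subset[OF sub fin] by simp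
    show "\<forall>e\<in>E. \<forall>f\<in>E. e \<noteq> f \<longrightarrow> (e \<times> e - Id) \<inter> (f \<times> f - Id) = {}"
      using lin by blast
  qed
  also have "\<dots> \<le> (\<Sum>(u, v)\<in>V \<times> V - Id. x u * x v)"
    by (rule sum_mono2) (use fin sub nn in auto)
  finally have qsum: "(\<Sum>e\<in>E. q e) \<le> S\<^sup>2 - (\<Sum>v\<in>V. (x v)\<^sup>2)"
    by (simp add: diag)
  have squares: "3 * g\<^sup>2 \<le> (\<Sum>v\<in>V. (x v)\<^sup>2)"
  proof -
    obtain a b c where abc: "m = {a, b, c}" "a \<noteq> b" "b \<noteq> c" "a \<noteq> c"
      using three[OF m(1)] by (auto simp: card_3_iff)
    define s where "s = (\<Sum>v\<in>m. (x v)\<^sup>2)"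
    have s: "s = (x a)\<^sup>2 + (x b)\<^sup>2 + (x c)\<^sup>2"
      using abc by (simp add: s_def)
    have tm: "t m = x a * x b * x c"
      using abc by (simp add: t_def)
    \<comment> \<open>AM-GM for the squared weights on the heaviest edge \<open>m\<close>, compared
      after cubing to avoid roots.\<close>
    have "(3 * g\<^sup>2) ^ 3 = 27 * (g ^ 3)\<^sup>2"
      by (simp add: power_mult_distrib flip: power_mult)
    also have "\<dots> = 27 * ((x a)\<^sup>2 * (x b)\<^sup>2 * (x c)\<^sup>2)"
      by (simp add: g tm power_mult_distrib)
    also have "\<dots> \<le> s ^ 3"
      unfolding s by (intro amgm3_pow) auto
    finally have "3 * g\<^sup>2 \<le> s"
      by (rule power_le_imp_le_base[where n = 2, unfolded Suc_numeral semiring_norm]) (simp add: s)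
    also have "s \<le> (\<Sum>v\<in>V. (x v)\<^sup>2)"
      unfolding s_def by (rule sum_mono2) (use fin sub m in auto)
    finally show ?thesis .
  qed
  have "6 * (\<Sum>e\<in>E. t e) \<le> g * (\<Sum>e\<in>E. q e)"
    unfolding sum_distrib_left by (rule sum_mono) (rule edge)
  also have "\<dots> \<le> g * (S\<^sup>2 - 3 * g\<^sup>2)"
    using qsum squares g by (intro mult_left_mono) auto
  also have "\<dots> \<le> 6 * (S ^ 3 / 27)"
  proof -
    have "0 \<le> S"
      unfolding S_def using nn by (rule sum_nonneg)
    \<comment> \<open>This product is nine times the difference of the two sides; its double root is
      the maximiser \<open>g = S / 3\<close>.\<close>
    then have "0 \<le> (S - 3 * g)\<^sup>2 * (2 * S + 3 * g)"
      using g by (intro mult_nonneg_nonneg) auto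
    then show ?thesis
      by (simp add: power2_eq_square power3_eq_cube algebra_simps)
  qed
  finally show ?thesis
    by (simp add: t_def S_def)
qed

section \<open>Reduction to covered pairs by shifting weight\<close>

text \<open>If two vertices \<open>u\<close>, \<open>w\<close> lie in no common edge, the weight polynomial is linear along the
  direction that moves weight from one to the other, so all the weight of one of them can be moved
  without decreasing the polynomial.\<close>

lemma shift_weight:
  fixes x :: "'a \<Rightarrow> real"
  assumes finE: "finite E" and finite_edges: "\<And>e. e \<in> E \<Longrightarrow> finite e" and "0 \<le> x w"
    and nocover: "\<And>e. e \<in> E \<Longrightarrow> u \<in> e \<Longrightarrow> w \<notin> e"
    and link: "(\<Sum>e\<in>{e\<in>E. w \<in> e}. \<Prod>v\<in>e - {w}. x v) \<le> (\<Sum>e\<in>{e\<in>E. u \<in> e}. \<Prod>v\<in>e - {u}. x v)"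
  shows "(\<Sum>e\<in>E. \<Prod>v\<in>e. x v) \<le> (\<Sum>e\<in>{e\<in>E. w \<notin> e}. \<Prod>v\<in>e. (x(u := x u + x w)) v)"
proof -
  define y where "y = x(u := x u + x w)"
  \<comment> \<open>\<open>L z\<close> is the partial derivative of the weight polynomial in the
    weight of \<open>z\<close>.\<close>
  define L where "L z = (\<Sum>e\<in>{e\<in>E. z \<in> e}. \<Prod>v\<in>e - {z}. x v)" for z
  have "(\<Sum>e\<in>E. \<Prod>v\<in>e. x v) = (\<Sum>e\<in>{e\<in>E. w \<notin> e}. \<Prod>v\<in>e. x v) + (\<Sum>e\<in>{e\<in>E. w \<in> e}. \<Prod>v\<in>e. x v)"
    using finE by (subst sum.union_disjoint[symmetric]) (auto intro!: sum.cong)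
  also have "(\<Sum>e\<in>{e\<in>E. w \<in> e}. \<Prod>v\<in>e. x v) = x w * L w"
    unfolding L_def sum_distrib_left
    by (rule sum.cong) (use finite_edges in \<open>auto simp: prod.remove\<close>)
  also have "x w * L w \<le> x w * L u"
    using link assms(3) by (auto simp: L_def intro: mult_left_mono)
  also have "(\<Sum>e\<in>{e\<in>E. w \<notin> e}. \<Prod>v\<in>e. x v) + x w * L u = (\<Sum>e\<in>{e\<in>E. w \<notin> e}. \<Prod>v\<in>e. y v)"
  proof -
    have *: "(\<Prod>v\<in>e. y v) = (\<Prod>v\<in>e. x v) + (if u \<in> e then x w * (\<Prod>v\<in>e - {u}. x v) else 0)"
      if "e \<in> E" for e
    proof (cases "u \<in> e")
      case True
      have "(\<Prod>v\<in>e. y v) = y u * (\<Prod>v\<in>e - {u}. y v)"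
        using True finite_edges that by (simp add: prod.remove)
      also have "(\<Prod>v\<in>e - {u}. y v) = (\<Prod>v\<in>e - {u}. x v)"
        by (rule prod.cong) (auto simp: y_def)
      finally have "(\<Prod>v\<in>e. y v) = (x u + x w) * (\<Prod>v\<in>e - {u}. x v)"
        by (simp add: y_def)
      moreover have "(\<Prod>v\<in>e. x v) = x u * (\<Prod>v\<in>e - {u}. x v)"
        using True finite_edges that by (simp add: prod.remove)
      ultimately show ?thesis
        using True by (simp add: algebra_simps)
    next
      case False
      then show ?thesis
        by (auto simp: y_def intro!: prod.cong)
    qed
    \<comment> \<open>Deleting the edges through \<open>w\<close> loses no edge through
      \<open>u\<close>, so the gain from the larger weight of \<open>u\<close> is the full
      \<open>x w * L u\<close>.\<close>
    have "{e \<in> {e \<in> E. w \<notin> e}. u \<in> e} = {e \<in> E. u \<in> e}"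
      using nocover by blast
    then have "(\<Sum>e\<in>{e\<in>E. w \<notin> e}. if u \<in> e then x w * (\<Prod>v\<in>e - {u}. x v) else 0) = x w * L u"
      unfolding L_def sum_distrib_left using finE by (simp flip: sum.inter_filter)
    moreover have "(\<Sum>e\<in>{e\<in>E. w \<notin> e}. \<Prod>v\<in>e. y v) = (\<Sum>e\<in>{e\<in>E. w \<notin> e}.
        (\<Prod>v\<in>e. x v) + (if u \<in> e then x w * (\<Prod>v\<in>e - {u}. x v) else 0))"
      by (rule sum.cong) (simp_all add: *)
    ultimately show ?thesis
      by (simp add: sum.distrib)
  qed
  finally show ?thesis
    by (simp add: y_def)
qed

text \<open>Induction on the number of vertices, for all weights at once: an uncovered pair lets one
  vertex be deleted and its weight passed to the other; without such a pair the system is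
  linear.\<close>

lemma cancellative_triple_system_weight_le:
  fixes x :: "'a \<Rightarrow> real"
  assumes "finite V" "\<And>v. v \<in> V \<Longrightarrow> 0 \<le> x v"
    and "\<And>e. e \<in> E \<Longrightarrow> e \<subseteq> V" and "\<And>e. e \<in> E \<Longrightarrow> card e = 3" and "cancellative E"
  shows "(\<Sum>e\<in>E. \<Prod>v\<in>e. x v) \<le> (\<Sum>v\<in>V. x v) ^ 3 / 27"
  using assms
proof (induction "card V" arbitrary: V E x rule: less_induct)
  case less
  note fin = less.prems(1) and nn = less.prems(2) and sub = less.prems(3)
    and three = less.prems(4) and canc = less.prems(5)
  have finE: "finite E"
    using fin sub by (meson Pow_iff finite_Pow_iff finite_subset subsetI)
  define L where "L z = (\<Sum>e\<in>{e\<in>E. z \<in> e}. \<Prod>v\<in>e - {z}. x v)" for z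
  show ?case
  proof (cases "\<exists>u\<in>V. \<exists>w\<in>V. u \<noteq> w \<and> (\<forall>e\<in>E. u \<in> e \<longrightarrow> w \<notin> e)")
    case True
    \<comment> \<open>Being uncovered is symmetric in \<open>u\<close> and \<open>w\<close>, so
      \<open>w\<close> can be chosen as the vertex with the smaller link weight.\<close>
    then obtain u w where uw: "u \<in> V" "w \<in> V" "u \<noteq> w" "\<And>e. e \<in> E \<Longrightarrow> u \<in> e \<Longrightarrow> w \<notin> e"
      and le: "L w \<le> L u"
      by (metis linear)
    define y where "y = x(u := x u + x w)"
    have "(\<Sum>e\<in>E. \<Prod>v\<in>e. x v) \<le> (\<Sum>e\<in>{e\<in>E. w \<notin> e}. \<Prod>v\<in>e. y v)"
      unfolding y_def
      by (rule shift_weight) (use finE nn uw le finite_subset[OF sub fin] L_def in auto)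
    also have "\<dots> \<le> (\<Sum>v\<in>V - {w}. y v) ^ 3 / 27"
    proof (rule less.hyps)
      show "card (V - {w}) < card V"
        using fin uw by (meson card_Diff1_less)
      show "cancellative {e \<in> E. w \<notin> e}"
        using canc by (rule cancellative_subset) auto
    qed (use fin nn sub three uw y_def in auto)
    also have "(\<Sum>v\<in>V - {w}. y v) = (\<Sum>v\<in>V. x v)"
    proof -
      have "(\<Sum>v\<in>V - {w}. y v) = y u + (\<Sum>v\<in>V - {w} - {u}. y v)"
        using fin uw by (intro sum.remove) auto
      also have "(\<Sum>v\<in>V - {w} - {u}. y v) = (\<Sum>v\<in>V - {w} - {u}. x v)"
        by (rule sum.cong) (auto simp: y_def)
      also have "y u + \<dots> = x w + (x u + (\<Sum>v\<in>V - {w} - {u}. x v))"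
        by (simp add: y_def)
      also have "x u + (\<Sum>v\<in>V - {w} - {u}. x v) = (\<Sum>v\<in>V - {w}. x v)"
        using fin uw by (intro sum.remove[symmetric]) auto
      also have "x w + \<dots> = (\<Sum>v\<in>V. x v)"
        using fin uw by (intro sum.remove[symmetric]) auto
      finally show ?thesis .
    qed
    finally show ?thesis .
  next
    case False
    show ?thesis
    proof (rule linear_triple_system_weight_le[OF fin nn sub three])
      show "e = f" if "e \<in> E" "f \<in> E" "u \<in> e \<inter> f" "v \<in> e \<inter> f" "u \<noteq> v" for e f u v
        by (rule cancellative_covering_imp_linear[OF canc three _ that])
          (use False sub in blast)+
    qed auto
  qed
qed

corollary card_cancellative_triple_system_le:
  assumes "finite V" "\<And>e. e \<in> E \<Longrightarrow> e \<subseteq> V" "\<And>e. e \<in> E \<Longrightarrow> card e = 3" "cancellative E"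
  shows "real (card E) \<le> real (card V) ^ 3 / 27"
  using cancellative_triple_system_weight_le[of V "\<lambda>_. 1" E] assms by simp

section \<open>Complexes without a copy of \<open>F\<close>\<close>

lemma contains_copy_F_complex_iff:
  assumes "simplicial_complex H"
  shows "contains_copy H F_complex \<longleftrightarrow>
    (\<exists>a b c d. distinct [a, b, c, d] \<and> {a, b, c} \<in> snd H \<and> {b, c, d} \<in> snd H \<and> {a, d} \<in> snd H)"
proof
  assume "contains_copy H F_complex"
  then obtain \<phi> where inj: "inj_on \<phi> {1 :: nat, 2, 3, 4}"
    and edge: "\<And>e. e \<in> down_closure {{1, 2, 3}, {2, 3, 4}, {1, 4}} \<Longrightarrow> \<phi> ` e \<in> snd H"
    unfolding contains_copy_def F_complex_def by auto
  have "\<phi> ` {1, 2, 3} \<in> snd H" "\<phi> ` {2, 3, 4} \<in> snd H" "\<phi> ` {1, 4} \<in> snd H"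
    by (rule edge, force simp: down_closure_def)+
  moreover have "distinct [\<phi> 1, \<phi> 2, \<phi> 3, \<phi> 4]"
    using inj by auto
  ultimately show "\<exists>a b c d. distinct [a, b, c, d] \<and> {a, b, c} \<in> snd H \<and> {b, c, d} \<in> snd H \<and> {a, d} \<in> snd H"
    by (intro exI[of _ "\<phi> 1"] exI[of _ "\<phi> 2"] exI[of _ "\<phi> 3"] exI[of _ "\<phi> 4"] conjI)
      (simp_all only: image_insert image_empty)
next
  assume "\<exists>a b c d. distinct [a, b, c, d] \<and> {a, b, c} \<in> snd H \<and> {b, c, d} \<in> snd H \<and> {a, d} \<in> snd H"
  then obtain a b c d where abcd: "distinct [a, b, c, d]" "{a, b, c} \<in> snd H" "{b, c, d} \<in> snd H" "{a, d} \<in> snd H"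
    by blast
  \<comment> \<open>The shift by one is there because the vertices of \<open>F_complex\<close> are
    numbered from 1.\<close>
  define \<phi> :: "nat \<Rightarrow> 'a" where "\<phi> i = [a, b, c, d] ! (i - 1)" for i
  have \<phi>: "\<phi> 1 = a" "\<phi> 2 = b" "\<phi> 3 = c" "\<phi> 4 = d"
    by (simp_all add: \<phi>_def numeral_eq_Suc)
  have down: "f \<in> snd H" if "e \<in> snd H" "f \<subseteq> e" for e f
    using assms that unfolding simplicial_complex_def by blast
  have "\<phi> ` e \<in> snd H" if "e \<in> snd F_complex" for e
  proof -
    have "\<exists>e'\<in>{{1, 2, 3}, {2, 3, 4}, {1, 4}}. e \<subseteq> e'"
      using that unfolding F_complex_def down_closure_def snd_conv mem_Collect_eq .
    then obtain e' where e': "e' \<in> {{1, 2, 3}, {2, 3, 4}, {1, 4}}" "e \<subseteq> e'"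
      by (rule bexE)
    have "\<phi> ` e' \<in> snd H"
      using e'(1) abcd \<phi> by auto
    then show ?thesis
      using down e'(2) by blast
  qed
  moreover have "{a, b, c, d} \<subseteq> fst H"
    using assms abcd unfolding simplicial_complex_def by blast
  ultimately show "contains_copy H F_complex"
    unfolding contains_copy_def
    using abcd(1) \<phi> by (intro exI[of _ \<phi>]) (auto simp: F_complex_def)
qed

text \<open>Every subset of an edge is an edge, so any four vertices of a larger edge would carry a
  copy.\<close>

lemma F_free_card_edge_le_3:
  assumes H: "simplicial_complex H" "\<not> contains_copy H F_complex" and e: "e \<in> snd H"
  shows "card e \<le> 3"
proof (rule ccontr)
  assume "\<not> card e \<le> 3"
  then have "4 \<le> card e" by simp
  then obtain f where f: "f \<subseteq> e" "card f = 4"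
    by (meson obtain_subset_with_card_n)
  then obtain a B where aB: "f = insert a B" "a \<notin> B" "card B = 3"
    by (metis Suc_numeral card_Suc_eq semiring_norm(2) semiring_norm(8))
  then obtain b c d where "B = {b, c, d}" "b \<noteq> c" "c \<noteq> d" "b \<noteq> d"
    by (auto simp: card_3_iff)
  then have "distinct [a, b, c, d]" "{a, b, c, d} \<subseteq> e"
    using aB f by auto
  moreover have "s \<in> snd H" if "s \<subseteq> e" for s
    using H(1) e that unfolding simplicial_complex_def by blast
  ultimately have "distinct [a, b, c, d] \<and> {a, b, c} \<in> snd H \<and> {b, c, d} \<in> snd H \<and> {a, d} \<in> snd H"
    by simp
  then show False
    using contains_copy_F_complex_iff[OF H(1)] H(2) by blast
qed

text \<open>A violation consists of \<open>A = {a, b, c}\<close>, \<open>B = {b, c, d}\<close> and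
  an edge \<open>C\<close> containing \<open>{a, d}\<close>, which is a copy.\<close>

lemma F_free_triples_cancellative:
  assumes H: "simplicial_complex H" "\<not> contains_copy H F_complex"
  shows "cancellative {e \<in> snd H. card e = 3}"
  unfolding cancellative_def
proof (intro ballI impI notI)
  fix A B C
  assume A: "A \<in> {e \<in> snd H. card e = 3}" and B: "B \<in> {e \<in> snd H. card e = 3}"
    and C: "C \<in> {e \<in> snd H. card e = 3}" and "A \<noteq> B" and AB: "sym_diff A B \<subseteq> C"
  have fin: "finite A" "finite B" "finite C"
    using A B C by (auto intro: card_ge_0_finite)
  have card: "card A = card (A \<inter> B) + card (A - B)" "card B = card (A \<inter> B) + card (B - A)"
    using card_Int_Diff[OF fin(1), of B] card_Int_Diff[OF fin(2), of A] by (simp_all add: Int_commute)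
  \<comment> \<open>Both differences have the same size because \<open>A\<close> and
    \<open>B\<close> do, so twice that size is at most 3.\<close>
  have "card (A - B) + card (B - A) = card (sym_diff A B)"
    using fin by (intro card_Un_disjoint[symmetric]) auto
  also have "\<dots> \<le> 3"
    using card_mono[OF fin(3) AB] C by simp
  finally have "card (A - B) \<le> 1"
    using card A B by simp
  moreover have "card (A - B) \<noteq> 0"
  proof
    assume "card (A - B) = 0"
    then have "A \<subseteq> B" using fin by auto
    then show False
      using \<open>A \<noteq> B\<close> A B card_subset_eq[OF fin(2)] by simp
  qed
  ultimately have "card (A - B) = 1" "card (B - A) = 1" "card (A \<inter> B) = 2"
    using card A B by auto
  then obtain a b c d where *: "A - B = {a}" "B - A = {d}" "A \<inter> B = {b, c}" "b \<noteq> c"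
    by (auto simp: card_1_singleton_iff card_2_iff)
  then have "A = {a, b, c}" "B = {b, c, d}" "{a, d} \<subseteq> C"
    using AB by blast+
  moreover have "distinct [a, b, c, d]"
    using * by auto
  moreover have "s \<in> snd H" if "s \<subseteq> C" for s
    using H(1) C that unfolding simplicial_complex_def by blast
  ultimately have "distinct [a, b, c, d] \<and> {a, b, c} \<in> snd H \<and> {b, c, d} \<in> snd H \<and> {a, d} \<in> snd H"
    using A B by auto
  then show False
    using contains_copy_F_complex_iff[OF H(1)] H(2) by blast
qed

text \<open>All sets of at most two vertices are counted as if they were edges, which costs only a
  quadratic term.\<close>

lemma card_F_free_le:
  assumes H: "simplicial_complex H" "\<not> contains_copy H F_complex"
    and fin: "finite (fst H)" and card: "card (fst H) = n"
  shows "real (card (snd H)) \<le> 1 + real n + real n ^ 2 + real n ^ 3 / 27"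
proof -
  define P where "P k = {e. e \<subseteq> fst H \<and> card e = k}" for k
  define T where "T = {e \<in> snd H. card e = 3}"
  have sub: "snd H \<subseteq> Pow (fst H)"
    using H(1) unfolding simplicial_complex_def by blast
  have "snd H \<subseteq> (P 0 \<union> P 1 \<union> P 2) \<union> T"
  proof
    fix e assume e: "e \<in> snd H"
    then have "card e \<in> {0, 1, 2, 3}"
      using F_free_card_edge_le_3[OF H e] by auto
    then show "e \<in> (P 0 \<union> P 1 \<union> P 2) \<union> T"
      using e sub unfolding P_def T_def by auto
  qed
  moreover have finP: "finite (P k)" for k
    unfolding P_def using fin by simp
  moreover have "finite T"
    unfolding T_def using finite_subset[OF sub] fin by simp
  ultimately have "card (snd H) \<le> card ((P 0 \<union> P 1 \<union> P 2) \<union> T)"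
    by (intro card_mono) auto
  also have "\<dots> \<le> (card (P 0) + card (P 1) + card (P 2)) + card T"
    by (meson add_mono card_Un_le le_trans order_refl)
  also have "\<dots> = 1 + n + (n choose 2) + card T"
    unfolding P_def using n_subsets[OF fin] card by simp
  also have "\<dots> \<le> 1 + n + n ^ 2 + card T"
    by (cases "2 \<le> n") (auto intro: binomial_le_pow simp: binomial_eq_0)
  finally have "card (snd H) \<le> 1 + n + n ^ 2 + card T" .
  then have "real (card (snd H)) \<le> real (1 + n + n ^ 2 + card T)"
    by (rule of_nat_mono)
  moreover have "real (card T) \<le> real n ^ 3 / 27"
    unfolding card[symmetric] T_def
    by (rule card_cancellative_triple_system_le[OF fin _ _ F_free_triples_cancellative[OF H]])
      (use sub in auto)
  ultimately show ?thesis by simp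
qed

section \<open>Lower bound construction\<close>

text \<open>Injectivity of the residue says that an edge meets each of the three parts at most
  once.\<close>

definition mod3_complex :: "nat \<Rightarrow> nat complex_pair" where
  "mod3_complex n = ({..<n}, {e. e \<subseteq> {..<n} \<and> inj_on (\<lambda>v. v mod 3) e})"

lemma simplicial_complex_mod3_complex: "simplicial_complex (mod3_complex n)"
  unfolding simplicial_complex_def mod3_complex_def by (auto intro: inj_on_subset)

text \<open>Any two of the four vertices of a copy share an edge, so they would need four different
  residues modulo 3.\<close>

lemma mod3_complex_F_free: "\<not> contains_copy (mod3_complex n) F_complex"
proof
  assume "contains_copy (mod3_complex n) F_complex"
  then obtain a b c d :: nat where "distinct [a, b, c, d]"
    "inj_on (\<lambda>v. v mod 3) {a, b, c}" "inj_on (\<lambda>v. v mod 3) {b, c, d}" "inj_on (\<lambda>v. v mod 3) {a, d}"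
    unfolding contains_copy_F_complex_iff[OF simplicial_complex_mod3_complex]
    by (auto simp: mod3_complex_def simp del: inj_on_insert)
  then have "distinct [a mod 3, b mod 3, c mod 3, d mod 3]"
    by (auto simp: inj_on_def)
  moreover have "v mod 3 \<in> {0, 1, 2}" for v :: nat
    by auto
  ultimately show False
    by (auto split: if_splits) metis+
qed

text \<open>Each part has at least \<open>n div 3\<close> vertices, and choosing one from each part
  gives an edge.\<close>

lemma card_mod3_complex_ge: "(n div 3) ^ 3 \<le> card (snd (mod3_complex n))"
proof -
  define m where "m = n div 3"
  define h :: "nat \<times> nat \<times> nat \<Rightarrow> nat set" where "h = (\<lambda>(i, j, k). {3 * i, 3 * j + 1, 3 * k + 2})"
  have "inj_on h ({..<m} \<times> {..<m} \<times> {..<m})"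
  proof (rule inj_on_inverseI)
    fix p :: "nat \<times> nat \<times> nat"
    obtain i j k where p: "p = (i, j, k)" by (cases p)
    have "{v \<in> h p. v mod 3 = 0} = {3 * i}" "{v \<in> h p. v mod 3 = 1} = {3 * j + 1}"
      "{v \<in> h p. v mod 3 = 2} = {3 * k + 2}"
      unfolding h_def p by (auto; presburger)+
    \<comment> \<open>The residue tells which coordinate an element encodes, and division by 3
      recovers the coordinate.\<close>
    then show "(\<lambda>s. (the_elem {v \<in> s. v mod 3 = 0} div 3, the_elem {v \<in> s. v mod 3 = 1} div 3,
        the_elem {v \<in> s. v mod 3 = 2} div 3)) (h p) = p"
      unfolding p by simp presburger
  qed
  then have "card (h ` ({..<m} \<times> {..<m} \<times> {..<m})) = m ^ 3"
    by (simp add: card_image power3_eq_cube)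
  moreover have "h ` ({..<m} \<times> {..<m} \<times> {..<m}) \<subseteq> snd (mod3_complex n)"
  proof clarify
    fix i j k assume "i < m" "j < m" "k < m"
    then have "3 * i < n" "3 * j + 1 < n" "3 * k + 2 < n"
      unfolding m_def by auto
    moreover have "3 * i mod 3 = 0" "(3 * j + 1) mod 3 = 1" "(3 * k + 2) mod 3 = 2"
      by presburger+
    ultimately show "h (i, j, k) \<in> snd (mod3_complex n)"
      unfolding h_def mod3_complex_def by (auto simp: inj_on_def)
  qed
  moreover have "finite (snd (mod3_complex n))"
    unfolding mod3_complex_def by simp
  ultimately show ?thesis
    unfolding m_def by (metis card_mono)
qed

section \<open>Asymptotics\<close>

lemma ex_num_F_complex_le: "real (ex_num n F_complex) \<le> 1 + real n + real n ^ 2 + real n ^ 3 / 27"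
proof -
  have "snd F_complex \<noteq> {}"
    by (auto simp: F_complex_def down_closure_def)
  then have "ex_num n F_complex \<in> free_edge_counts n F_complex"
    unfolding ex_num_def by (intro Max_in finite_free_edge_counts free_edge_counts_nonempty)
  then obtain H :: "nat complex_pair" where "ex_num n F_complex = card (snd H)"
    "simplicial_complex H" "\<not> contains_copy H F_complex" "finite (fst H)" "card (fst H) = n"
    unfolding free_edge_counts_def by blast
  then show ?thesis
    using card_F_free_le[of H n] by simp
qed

lemma ex_num_F_complex_ge: "((real n - 2) / 3) ^ 3 \<le> real (ex_num n F_complex)"
proof -
  have "card (snd (mod3_complex n)) \<in> free_edge_counts n F_complex"
    unfolding free_edge_counts_def
    using simplicial_complex_mod3_complex mod3_complex_F_free
    by (intro CollectI exI[of _ "mod3_complex n"]) (auto simp: mod3_complex_def)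
  then have "card (snd (mod3_complex n)) \<le> ex_num n F_complex"
    unfolding ex_num_def by (intro Max_ge finite_free_edge_counts)
  with card_mod3_complex_ge have "(n div 3) ^ 3 \<le> ex_num n F_complex"
    by (rule le_trans)
  then have "real (n div 3) ^ 3 \<le> real (ex_num n F_complex)"
    by (metis of_nat_le_iff of_nat_power)
  moreover have "n \<le> 3 * (n div 3) + 2"
    by presburger
  then have "real n \<le> real (3 * (n div 3) + 2)"
    by (rule of_nat_mono)
  then have "(real n - 2) / 3 \<le> real (n div 3)"
    by simp
  ultimately show ?thesis
    \<comment> \<open>The odd power is monotone on all reals; the base is negative when
      \<open>n < 2\<close>.\<close>
    using power_mono_odd[of 3 "(real n - 2) / 3" "real (n div 3)"] by (simp add: order_trans)
qed

lemma real_choose_3: "real (n choose 3) = real n * (real n - 1) * (real n - 2) / 6"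
  by (simp add: binomial_gbinomial gbinomial_prod_rev numeral_eq_Suc fact_numeral)

theorem theorem1p7:
  shows "\<forall>\<epsilon>::real. \<epsilon> > 0 \<longrightarrow>
    (\<exists>n0::nat. \<forall>n\<ge>n0.
      (2 / 9 - \<epsilon>) * real (n choose 3) \<le> real (ex_num n F_complex) \<and>
      real (ex_num n F_complex) \<le> (2 / 9 + \<epsilon>) * real (n choose 3))"
proof (intro allI impI)
  fix \<epsilon> :: real assume "\<epsilon> > 0"
  define b :: "nat \<Rightarrow> real" where "b n = real n * (real n - 1) * (real n - 2) / 6" for n
  \<comment> \<open>The leading coefficients are \<open>1 / 27\<close> and \<open>1 / 6\<close>,
    with quotient \<open>2 / 9\<close>; the upper bound below has the same ones.\<close>
  have "(\<lambda>n. ((real n - 2) / 3) ^ 3 / b n) \<longlonglongrightarrow> 2 / 9"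
    unfolding b_def by (real_asymp simp: power3_eq_cube)
  then have "\<forall>\<^sub>F n in sequentially. 2 / 9 - \<epsilon> < ((real n - 2) / 3) ^ 3 / b n"
    using \<open>\<epsilon> > 0\<close> by (intro order_tendstoD) auto
  moreover have "(\<lambda>n. (1 + real n + real n ^ 2 + real n ^ 3 / 27) / b n) \<longlonglongrightarrow> 2 / 9"
    unfolding b_def by real_asymp
  then have "\<forall>\<^sub>F n in sequentially. (1 + real n + real n ^ 2 + real n ^ 3 / 27) / b n < 2 / 9 + \<epsilon>"
    using \<open>\<epsilon> > 0\<close> by (intro order_tendstoD) auto
  moreover have "\<forall>\<^sub>F n in sequentially. 0 < b n"
    unfolding b_def by real_asymp
  ultimately have "\<forall>\<^sub>F n in sequentially.
      (2 / 9 - \<epsilon>) * real (n choose 3) \<le> real (ex_num n F_complex) \<and>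
      real (ex_num n F_complex) \<le> (2 / 9 + \<epsilon>) * real (n choose 3)"
  proof eventually_elim
    case (elim n)
    have "(2 / 9 - \<epsilon>) * b n \<le> ((real n - 2) / 3) ^ 3"
      using elim(1,3) by (simp add: less_divide_eq)
    moreover have "1 + real n + real n ^ 2 + real n ^ 3 / 27 \<le> (2 / 9 + \<epsilon>) * b n"
      using elim(2,3) by (simp add: divide_less_eq)
    ultimately show ?case
      using ex_num_F_complex_ge[of n] ex_num_F_complex_le[of n]
      unfolding real_choose_3 b_def[symmetric] by linarith
  qed
  then show "\<exists>n0. \<forall>n\<ge>n0.
      (2 / 9 - \<epsilon>) * real (n choose 3) \<le> real (ex_num n F_complex) \<and>
      real (ex_num n F_complex) \<le> (2 / 9 + \<epsilon>) * real (n choose 3)"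
    unfolding eventually_sequentially .
qed

end
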